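(* Let $G$ be a finite group. If $\kappa(G) < \frac{7}{4|G|}$ then $G$ is abelian. Moreover, $\kappa(G) = \frac{7}{4|G|}$ if and only if the index of the centre $Z(G)$ in $G$ is $4$.
   Context: For a finite group $G$, $\kappa(G)$ denotes the probability that $g$ and $h$ are conjugate in $G$, when $g,h\in G$ are chosen independently and uniformly at random from $G$. *)

theory Defs
  imports "HOL-Probability.Probability_Mass_Function" "HOL-Algebra.Coset"
begin

definition conjugate_in :: "('a, 'b) monoid_scheme \<Rightarrow> 'a \<Rightarrow> 'a \<Rightarrow> bool" where
  "conjugate_in G g h \<longleftrightarrow> g \<in> carrier G \<and> h \<in> carrier G \<and>
     (\<exists>x\<in>carrier G. x \<otimes>\<^bsub>G\<^esub> g \<otimes>\<^bsub>G\<^esub> inv\<^bsub>G\<^esub> x = h)"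

(* Only meaningful for finite G: pmf_of_set is specified only on finite nonempty sets.
   The product distribution pair_pmf expresses that g and h are chosen independently. *)
definition kappa :: "('a, 'b) monoid_scheme \<Rightarrow> real" where
  "kappa G = measure_pmf.prob
     (pair_pmf (pmf_of_set (carrier G)) (pmf_of_set (carrier G)))
     {(g, h). conjugate_in G g h}"

definition group_center :: "('a, 'b) monoid_scheme \<Rightarrow> 'a set" where
  "group_center G = {z \<in> carrier G. \<forall>g\<in>carrier G. z \<otimes>\<^bsub>G\<^esub> g = g \<otimes>\<^bsub>G\<^esub> z}"

definition subgroup_index :: "('a, 'b) monoid_scheme \<Rightarrow> 'a set \<Rightarrow> nat" where
  "subgroup_index G H = card (rcosets\<^bsub>G\<^esub> H)"

end

theory Submission
  imports Defs "HOL-Algebra.Group_Action"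
begin

text \<open>
  Fix the first element \<open>g\<close>: the second one is conjugate to it with probability
  \<open>s(g) / |G|\<close>, where \<open>s(g)\<close> is the size of the conjugacy class of \<open>g\<close>.  Thus
  \<open>\<kappa>(G) |G|\<close> is the average class size.  A central element has a class of size 1 and every
  other element has a class of size at least 2, so that this average is at least
  \<open>2 - |Z(G)| / |G|\<close> (lemma \<open>sum_class_sizes_lower_bound\<close>).

  If some \<open>g\<close> is not central, then \<open>Z(G) < C(g) < G\<close> is a strictly increasing chain of
  subgroups, since \<open>g\<close> itself lies in its centralizer \<open>C(g)\<close>.  By Lagrange, each inclusion at
  least doubles the order, hence \<open>|G| \<ge> 4 |Z(G)|\<close> and the average class size is at least
  \<open>7/4\<close>.

  In an abelian group the average class size is 1.  If it equals \<open>7/4\<close>, the group is therefore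
  not abelian and both estimates are equalities, so the index of the centre is 4.  Conversely, if
  that index is 4, the chain forces \<open>[G : C(g)] = 2\<close> for every non-central \<open>g\<close>; all
  non-central classes have size exactly 2 and the average is \<open>2 - 1/4\<close>.
\<close>

section \<open>Conjugacy classes, centralizers and the centre\<close>

definition centralizer :: "('a, 'b) monoid_scheme \<Rightarrow> 'a \<Rightarrow> 'a set" where
  "centralizer G g = {x \<in> carrier G. x \<otimes>\<^bsub>G\<^esub> g = g \<otimes>\<^bsub>G\<^esub> x}"

definition conjugacy_class :: "('a, 'b) monoid_scheme \<Rightarrow> 'a \<Rightarrow> 'a set" where
  "conjugacy_class G g = {h. conjugate_in G g h}"

lemma pair_pmf_of_set:
  assumes "finite A" "A \<noteq> {}" "finite B" "B \<noteq> {}"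
  shows "pair_pmf (pmf_of_set A) (pmf_of_set B) = pmf_of_set (A \<times> B)"
  by (rule pmf_eqI)
    (use assms in \<open>clarsimp simp: pmf_pair pmf_of_set indicator_def card_cartesian_product\<close>)

context group
begin

lemma conj_eq_self_iff_commute:
  assumes "x \<in> carrier G" "g \<in> carrier G"
  shows "x \<otimes> g \<otimes> inv x = g \<longleftrightarrow> x \<otimes> g = g \<otimes> x"
  using assms by (metis inv_solve_right m_closed)

lemma orbit_conjugation_eq_class:
  assumes "g \<in> carrier G"
  shows "orbit G (\<lambda>x. \<lambda>h\<in>carrier G. x \<otimes> h \<otimes> inv x) g = conjugacy_class G g"
  using assms by (auto simp: orbit_def conjugacy_class_def conjugate_in_def)

lemma stabilizer_conjugation_eq_centralizer:
  assumes "g \<in> carrier G"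
  shows "stabilizer G (\<lambda>x. \<lambda>h\<in>carrier G. x \<otimes> h \<otimes> inv x) g = centralizer G g"
  unfolding stabilizer_def centralizer_def
  by (rule Collect_cong) (simp add: assms conj_eq_self_iff_commute cong: conj_cong)

text \<open>
  Under conjugation, orbits are classes and stabilizers are centralizers, so that the subgroup
  property and the orbit-stabilizer formula come from the general theory of group actions.
\<close>

lemma centralizer_subgroup:
  assumes "g \<in> carrier G"
  shows "subgroup (centralizer G g) G"
  using group_action.stabilizer_subgroup[OF action_by_conjugation assms]
    stabilizer_conjugation_eq_centralizer[OF assms] by simp

lemma card_class_times_card_centralizer:
  assumes "g \<in> carrier G"
  shows "card (conjugacy_class G g) * card (centralizer G g) = order G"
  using group_action.orbit_stabilizer_theorem[OF action_by_conjugation assms]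
  by (simp add: orbit_conjugation_eq_class stabilizer_conjugation_eq_centralizer assms)

lemma center_eq_Inter_centralizers: "group_center G = (\<Inter>g\<in>carrier G. centralizer G g)"
  using one_closed by (auto simp: group_center_def centralizer_def)

lemma center_subgroup: "subgroup (group_center G) G"
  unfolding center_eq_Inter_centralizers
  by (rule subgroups_Inter) (use centralizer_subgroup one_closed in auto)

text \<open>Lagrange's theorem inside the group \<open>K\<close>.\<close>

lemma card_subgroup_dvd_card_subgroup:
  assumes "subgroup H G" "subgroup K G" "H \<subseteq> K"
  shows "card H dvd card K"
proof -
  interpret K: group "G\<lparr>carrier := K\<rparr>"
    by (rule subgroup_imp_group) fact
  have "subgroup H (G\<lparr>carrier := K\<rparr>)"
    using subgroup_incl assms by blast
  from K.lagrange[OF this] have "card (rcosets\<^bsub>G\<lparr>carrier := K\<rparr>\<^esub> H) * card H = card K"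
    by (simp add: order_def)
  then show ?thesis
    by (metis dvd_triv_right)
qed

lemma comm_group_iff_center: "comm_group G \<longleftrightarrow> group_center G = carrier G"
proof
  assume "comm_group G"
  then interpret comm_group G .
  show "group_center G = carrier G"
    by (auto simp: group_center_def m_comm)
next
  assume "group_center G = carrier G"
  then show "comm_group G"
    by (intro group_comm_groupI) (auto simp: group_center_def)
qed

lemma conjugacy_class_central:
  assumes "g \<in> group_center G"
  shows "conjugacy_class G g = {g}"
proof -
  have "g \<in> carrier G" and "\<And>x. x \<in> carrier G \<Longrightarrow> x \<otimes> g \<otimes> inv x = g"
    using assms by (auto simp: group_center_def conj_eq_self_iff_commute)
  then show ?thesis
    by (auto simp: conjugacy_class_def conjugate_in_def)
qed

end

section \<open>Class sizes in finite groups\<close>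

locale finite_group = group +
  assumes finite_carrier: "finite (carrier G)"
begin

lemma order_pos: "0 < order G"
  using finite_carrier by (simp add: order_gt_0_iff_finite)

lemma kappa_eq_sum_class_sizes:
  "kappa G = real (\<Sum>g\<in>carrier G. card (conjugacy_class G g)) / real (order G)^2"
proof -
  have "(carrier G \<times> carrier G) \<inter> {(g, h). conjugate_in G g h}
      = (SIGMA g:carrier G. conjugacy_class G g)"
    by (auto simp: conjugacy_class_def conjugate_in_def)
  moreover have "finite (conjugacy_class G g)" for g
    by (rule finite_subset[OF _ finite_carrier])
      (auto simp: conjugacy_class_def conjugate_in_def)
  ultimately show ?thesis
    using finite_carrier carrier_not_empty
    by (simp add: kappa_def pair_pmf_of_set measure_pmf_of_set card_cartesian_product
        order_def power2_eq_square)
qed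

lemma subgroup_index_center_times_card:
  "subgroup_index G (group_center G) * card (group_center G) = order G"
  unfolding subgroup_index_def by (rule lagrange[OF center_subgroup])

lemma card_center_pos: "0 < card (group_center G)"
  using subgroup_index_center_times_card order_pos by (metis mult_0_right neq0_conv)

text \<open>
  A non-central element lies in its own centralizer but not in the centre, and its centralizer is
  not the whole group; Lagrange turns these two strict inclusions into factors of at least 2.
\<close>

lemma noncentral_chain:
  assumes "g \<in> carrier G" "g \<notin> group_center G"
  shows "2 * card (group_center G) \<le> card (centralizer G g)"
    and "2 \<le> card (conjugacy_class G g)"
proof -
  let ?Z = "group_center G" and ?C = "centralizer G g"
  have C: "?C \<subseteq> carrier G"
    by (auto simp: centralizer_def)
  have "?Z \<subset> ?C"
    using assms by (auto simp: group_center_def centralizer_def)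
  then have "card ?Z < card ?C"
    using C finite_carrier by (meson finite_subset psubset_card_mono)
  moreover have "card ?Z dvd card ?C"
    using card_subgroup_dvd_card_subgroup[OF center_subgroup centralizer_subgroup]
      \<open>?Z \<subset> ?C\<close> assms by blast
  then obtain k where "card ?C = card ?Z * k" ..
  ultimately have "k \<noteq> 0" "k \<noteq> 1"
    by auto
  then have "2 \<le> k"
    by linarith
  then show "2 * card ?Z \<le> card ?C"
    unfolding \<open>card ?C = card ?Z * k\<close> by simp
  have "\<exists>x\<in>carrier G. x \<notin> ?C"
    using assms by (auto simp: group_center_def centralizer_def) metis
  with C have "?C \<subset> carrier G"
    by blast
  then have "card ?C < order G"
    unfolding order_def using finite_carrier by (rule psubset_card_mono[rotated])
  then have "card (conjugacy_class G g) \<noteq> 0" "card (conjugacy_class G g) \<noteq> 1"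
    using card_class_times_card_centralizer[OF assms(1)]
    by (metis mult_0 not_less_zero, metis mult_1 less_irrefl)
  then show "2 \<le> card (conjugacy_class G g)"
    by linarith
qed

lemma nonabelian_order_ge:
  assumes "\<not> comm_group G"
  shows "4 * card (group_center G) \<le> order G"
proof -
  obtain g where g: "g \<in> carrier G" "g \<notin> group_center G"
    using assms comm_group_iff_center by (auto simp: group_center_def)
  have "2 * (2 * card (group_center G)) \<le> card (conjugacy_class G g) * card (centralizer G g)"
    using noncentral_chain[OF g] by (intro mult_le_mono)
  then show ?thesis
    using card_class_times_card_centralizer[OF g(1)] by simp
qed

lemma sum_class_sizes_split:
  "(\<Sum>g\<in>carrier G. card (conjugacy_class G g))
    = card (group_center G)
      + (\<Sum>g\<in>carrier G - group_center G. card (conjugacy_class G g))"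
proof -
  have "group_center G \<subseteq> carrier G"
    by (auto simp: group_center_def)
  from sum.subset_diff[OF this finite_carrier, of "\<lambda>g. card (conjugacy_class G g)"]
  show ?thesis
    by (simp add: conjugacy_class_central)
qed

lemma card_noncentral:
  "card (group_center G) + card (carrier G - group_center G) = order G"
proof -
  have "group_center G \<subseteq> carrier G"
    by (auto simp: group_center_def)
  then show ?thesis
    using finite_carrier
    by (metis card_Diff_subset card_mono finite_subset le_add_diff_inverse order_def)
qed

text \<open>
  Each element contributes at least 2, except the central ones, which fall short by exactly 1;
  adding the order of the centre makes up for them.
\<close>

lemma sum_class_sizes_lower_bound:
  "2 * order G \<le> (\<Sum>g\<in>carrier G. card (conjugacy_class G g)) + card (group_center G)"
proof -
  have "(\<Sum>g\<in>carrier G - group_center G. 2)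
      \<le> (\<Sum>g\<in>carrier G - group_center G. card (conjugacy_class G g))"
    using noncentral_chain(2) by (intro sum_mono) auto
  then show ?thesis
    using card_noncentral by (simp add: sum_class_sizes_split)
qed

lemma sum_class_sizes_comm:
  assumes "comm_group G"
  shows "(\<Sum>g\<in>carrier G. card (conjugacy_class G g)) = order G"
  using assms by (simp add: comm_group_iff_center sum_class_sizes_split order_def)

text \<open>
  Index 4 leaves no room in the chain \<open>Z(G) < C(g) < G\<close>: with \<open>C(g)\<close> of order at least
  \<open>2 |Z(G)|\<close>, a non-central class cannot have more than 2 elements, and the lower bound is
  attained.
\<close>

lemma sum_class_sizes_index_4:
  assumes "order G = 4 * card (group_center G)"
  shows "(\<Sum>g\<in>carrier G. card (conjugacy_class G g)) + card (group_center G) = 2 * order G"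
proof -
  have "card (conjugacy_class G g) = 2" if "g \<in> carrier G - group_center G" for g
  proof -
    have g: "g \<in> carrier G" "g \<notin> group_center G"
      using that by auto
    let ?s = "card (conjugacy_class G g)" and ?z = "card (group_center G)"
    have "?s * (2 * ?z) \<le> ?s * card (centralizer G g)"
      using noncentral_chain(1)[OF g] by (rule mult_le_mono2)
    also have "\<dots> = 2 * (2 * ?z)"
      using card_class_times_card_centralizer[OF g(1)] assms by simp
    finally have "?s \<le> 2"
      using card_center_pos by simp
    with noncentral_chain(2)[OF g] show ?thesis
      by simp
  qed
  then show ?thesis
    using card_noncentral by (simp add: sum_class_sizes_split)
qed

end

section \<open>The gap above abelian groups and its extremal case\<close>

theorem theorem1p1:
  fixes G :: "('a, 'b) monoid_scheme"
  assumes "Group.group G" and "finite (carrier G)"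
  shows "(kappa G < 7 / (4 * real (Coset.order G)) \<longrightarrow> comm_group G) \<and>
    (kappa G = 7 / (4 * real (Coset.order G)) \<longleftrightarrow> subgroup_index G (group_center G) = 4)"
proof -
  interpret finite_group G
    using assms by (simp add: finite_group_def finite_group_axioms_def)
  define S where "S = (\<Sum>g\<in>carrier G. card (conjugacy_class G g))"
  \<comment> \<open>Clearing denominators moves the question to natural numbers.\<close>
  have less_iff: "kappa G < 7 / (4 * real (order G)) \<longleftrightarrow> 4 * S < 7 * order G"
  proof -
    have "kappa G < 7 / (4 * real (order G)) \<longleftrightarrow> 4 * real S < 7 * real (order G)"
      using order_pos
      by (simp add: kappa_eq_sum_class_sizes S_def[symmetric] field_simps power2_eq_square)
    then show ?thesis
      by linarith
  qed
  have eq_iff: "kappa G = 7 / (4 * real (order G)) \<longleftrightarrow> 4 * S = 7 * order G"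
  proof -
    have "kappa G = 7 / (4 * real (order G)) \<longleftrightarrow> 4 * real S = 7 * real (order G)"
      using order_pos
      by (simp add: kappa_eq_sum_class_sizes S_def[symmetric] field_simps power2_eq_square)
    then show ?thesis
      by linarith
  qed
  have index_iff:
    "subgroup_index G (group_center G) = 4 \<longleftrightarrow> order G = 4 * card (group_center G)"
    using subgroup_index_center_times_card card_center_pos
    by (metis mult_cancel2 neq0_conv)
  have lower: "2 * order G \<le> S + card (group_center G)"
    unfolding S_def by (rule sum_class_sizes_lower_bound)
  have "comm_group G" if "4 * S < 7 * order G"
    using that lower nonabelian_order_ge by fastforce
  moreover have "order G = 4 * card (group_center G)" if "4 * S = 7 * order G"
  proof -
    have "\<not> comm_group G"
      using that sum_class_sizes_comm order_pos by (auto simp: S_def)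
    with nonabelian_order_ge that lower show ?thesis
      by linarith
  qed
  moreover have "4 * S = 7 * order G" if "order G = 4 * card (group_center G)"
    using sum_class_sizes_index_4[OF that] that by (simp add: S_def)
  ultimately show ?thesis
    unfolding less_iff eq_iff index_iff by blast
qed

end
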